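(* Let $\beta_0,\beta_1,\beta_2\in\mathbb{R}$ with $\beta_2<0$ and $\beta_2<20\beta_1$, and let $M\in[0,2)$. Then the ground state $\bm{\xi}_g$ of the spatially uniform problem (the minimizer of $\mathcal{E}_U$ over $\mathbb{S}_C$) is in the nematic phase. Moreover: (a) if $0<M<2$, then $\bm{\xi}_g$ can be given explicitly by $$\bm{\xi}_g=\left(\frac{\sqrt{2+M}}{2},\,0,\,0,\,0,\,\frac{\sqrt{2-M}}{2}\right)^T;$$ (b) if $M=0$, then $\bm{\xi}_g$ can be taken in either of the following two types: $$\bm{\xi}_g=(\gamma_1\cos\theta,\ \gamma_1\sin\theta,\ \gamma,\ -\gamma_1\sin\theta,\ \gamma_1\cos\theta)^T,$$ or $$\bm{\xi}_g=\left(\frac{\cos\theta}{\sqrt2},\ \frac{\sin\theta}{\sqrt2},\ 0,\ \frac{\sin\theta}{\sqrt2},\ -\frac{\cos\theta}{\sqrt2}\right)^T,$$ where $\gamma_1=\sqrt{\frac{1-\gamma^2}{2}}$ for any $\gamma\in\mathbb{R}$ with $|\gamma|\le1$, and $\theta\in[0,2\pi)$.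
   Context: Vectors are written $\bm{\xi}=(\xi_2,\xi_1,\xi_0,\xi_{-1},\xi_{-2})^T\in\mathbb{C}^5$. Define $$\tau(\bm{\xi})=2(\bar\xi_2\xi_1+\bar\xi_{-1}\xi_{-2})+\sqrt6(\bar\xi_1\xi_0+\bar\xi_0\xi_{-1}),\qquad \delta(\bm{\xi})=2\xi_2\xi_{-2}-2\xi_1\xi_{-1}+\xi_0^2,$$ $$\mathcal{E}_U(\bm{\xi})=\frac12\Big[\beta_1|\tau(\bm{\xi})|^2+\frac{\beta_2}{5}|\delta(\bm{\xi})|^2+\beta_0+\beta_1M^2\Big],$$ $$\mathbb{S}_C=\Big\{\bm{\xi}\in\mathbb{C}^5:\ \sum_{\ell=-2}^2|\xi_\ell|^2=1,\ \sum_{\ell=-2}^2\ell|\xi_\ell|^2=M\Big\}.$$ A ground state is a minimizer of $\mathcal{E}_U$ over $\mathbb{S}_C$; ground states differing by phase rotations $\xi_\ell\mapsto e^{i(\theta_0+\ell(\theta_1-\theta_0))}\xi_\ell$, $\theta_0,\theta_1\in\mathbb{R}$, are regarded as the same. It is in the ferromagnetic phase if $|\tau(\bm{\xi}_g)|>0$ and $\delta(\bm{\xi}_g)=0$; in the nematic phase if $\tau(\bm{\xi}_g)=0$ and $|\delta(\bm{\xi}_g)|>0$; in the cyclic phase if $\tau(\bm{\xi}_g)=\delta(\bm{\xi}_g)=0$. "Can be given by" or "can be taken as" a vector means that this vector is a ground state. *)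

theory Defs
  imports "HOL-Analysis.Analysis"
begin

text \<open>
  A vector \<open>(\<xi>\<^sub>2, \<xi>\<^sub>1, \<xi>\<^sub>0, \<xi>\<^bsub>-1\<^esub>, \<xi>\<^bsub>-2\<^esub>)\<close> is an element of \<open>complex ^ 5\<close>, listed in this order, so the
  component with magnetic quantum number \<open>l\<close> sits at position \<open>3 - l\<close>; only \<open>-2 \<le> l \<le> 2\<close> is
  meaningful, since the index type \<open>5\<close> is cyclic (and \<open>5 = 0\<close> in it).
\<close>

definition spin_comp :: "complex ^ 5 \<Rightarrow> int \<Rightarrow> complex"
  where "spin_comp \<xi> l = \<xi> $ of_int (3 - l)"

lemma spin_comp_vector:
  "spin_comp (vector [a, b, c, d, e]) 2 = a"
  "spin_comp (vector [a, b, c, d, e]) 1 = b"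
  "spin_comp (vector [a, b, c, d, e]) 0 = c"
  "spin_comp (vector [a, b, c, d, e]) (- 1) = d"
  "spin_comp (vector [a, b, c, d, e]) (- 2) = e"
  by (simp_all add: spin_comp_def vector_def)

definition \<tau> :: "complex ^ 5 \<Rightarrow> complex"
  where "\<tau> \<xi> =
    2 * (cnj (spin_comp \<xi> 2) * spin_comp \<xi> 1 + cnj (spin_comp \<xi> (- 1)) * spin_comp \<xi> (- 2))
    + complex_of_real (sqrt 6) *
      (cnj (spin_comp \<xi> 1) * spin_comp \<xi> 0 + cnj (spin_comp \<xi> 0) * spin_comp \<xi> (- 1))"

definition \<delta> :: "complex ^ 5 \<Rightarrow> complex"
  where "\<delta> \<xi> =
    2 * spin_comp \<xi> 2 * spin_comp \<xi> (- 2) - 2 * spin_comp \<xi> 1 * spin_comp \<xi> (- 1)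
    + (spin_comp \<xi> 0)\<^sup>2"

definition energy :: "real \<Rightarrow> real \<Rightarrow> real \<Rightarrow> real \<Rightarrow> complex ^ 5 \<Rightarrow> real"
  where "energy \<beta>\<^sub>0 \<beta>\<^sub>1 \<beta>\<^sub>2 M \<xi> =
    1 / 2 * (\<beta>\<^sub>1 * (norm (\<tau> \<xi>))\<^sup>2 + \<beta>\<^sub>2 / 5 * (norm (\<delta> \<xi>))\<^sup>2 + \<beta>\<^sub>0 + \<beta>\<^sub>1 * M\<^sup>2)"

definition feasible_set :: "real \<Rightarrow> (complex ^ 5) set"
  where "feasible_set M =
    {\<xi>. (\<Sum>l\<in>{-2..2}. (norm (spin_comp \<xi> l))\<^sup>2) = 1 \<and>
        (\<Sum>l\<in>{-2..2}. real_of_int l * (norm (spin_comp \<xi> l))\<^sup>2) = M}"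

text \<open>
  Ground states are individual vectors here. The identification of ground states that differ by a
  phase rotation needs no quotient: such a rotation preserves \<open>feasible_set\<close>, \<open>\<bar>\<tau>\<bar>\<close> and \<open>\<bar>\<delta>\<bar>\<close>.
\<close>

definition ground_state :: "real \<Rightarrow> real \<Rightarrow> real \<Rightarrow> real \<Rightarrow> complex ^ 5 \<Rightarrow> bool"
  where "ground_state \<beta>\<^sub>0 \<beta>\<^sub>1 \<beta>\<^sub>2 M =
    is_arg_min (energy \<beta>\<^sub>0 \<beta>\<^sub>1 \<beta>\<^sub>2 M) (\<lambda>\<xi>. \<xi> \<in> feasible_set M)"

definition nematic :: "complex ^ 5 \<Rightarrow> bool"
  where "nematic \<xi> \<longleftrightarrow> \<tau> \<xi> = 0 \<and> norm (\<delta> \<xi>) > 0"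

end

theory Submission
  imports Defs
begin

text \<open>
  Write \<open>F\<^sub>z, F\<^sub>+, F\<^sub>-\<close> for the spin-2 matrices. In a feasible state \<open>\<xi>\<close> the expectation
  values of \<open>F\<^sub>z\<close> and \<open>F\<^sub>+\<close> are \<open>M\<close> and \<open>\<tau>\<close>, so \<open>M\<^sup>2 + \<bar>\<tau>\<bar>\<^sup>2\<close> is the squared
  length of its spin vector, and \<open>\<delta> = \<langle>\<Theta>\<xi>, \<xi>\<rangle>\<close> is the overlap of \<open>\<xi>\<close> with its time reversal \<open>\<Theta>\<xi>\<close>. Everything follows from
  the inequality \<open>M\<^sup>2 + \<bar>\<tau>\<bar>\<^sup>2 + 4 \<bar>\<delta>\<bar>\<^sup>2 \<le> 4\<close> on the feasible set (\<open>spin_singlet_bound\<close>).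

  It holds for the following reason. Let \<open>G\<close> be the spin operator along the spin vector of \<open>\<xi>\<close>,
  scaled by the length \<open>f\<close> of that vector. Then \<open>\<langle>\<xi>, G\<xi>\<rangle> = f\<^sup>2\<close>. Time reversal anticommutes with spin,
  which makes \<open>G\<xi>\<close> orthogonal to \<open>\<Theta>\<xi>\<close> (\<open>spin_op_orthogonal\<close>). So \<open>\<xi>\<close> may be replaced in \<open>\<langle>\<xi>, G\<xi>\<rangle>\<close> by its component
  orthogonal to \<open>\<Theta>\<xi>\<close>, whose squared norm is \<open>1 - \<bar>\<delta>\<bar>\<^sup>2\<close>. As the eigenvalues of a spin-2 component
  are at most 2 in modulus (\<open>norm_spin_op_le\<close>), Cauchy-Schwarz gives
  \<open>f\<^sup>2 \<le> 2 f sqrt (1 - \<bar>\<delta>\<bar>\<^sup>2)\<close>, which is the inequality.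

  Since \<open>\<beta>\<^sub>2 < 0\<close>, the \<open>\<delta>\<close> term of the energy is at least \<open>\<beta>\<^sub>2 / 10 * (1 - M\<^sup>2 / 4 - \<bar>\<tau>\<bar>\<^sup>2 / 4)\<close>, and
  \<open>\<beta>\<^sub>2 < 20 \<beta>\<^sub>1\<close> makes the total coefficient of \<open>\<bar>\<tau>\<bar>\<^sup>2\<close> positive. Dropping the terms in \<open>\<tau>\<close> gives a lower
  bound that is constant on the feasible set. This bound is attained
  exactly when \<open>\<tau> = 0\<close> and \<open>\<bar>\<delta>\<bar>\<^sup>2 = 1 - M\<^sup>2 / 4\<close>. The state supported on the components \<open>\<plusminus>2\<close>
  attains it for every \<open>M\<close> in question, so these two equations characterise the ground states
  (\<open>ground_state_iff\<close>). They imply the nematic phase because \<open>M < 2\<close>, and the listed vectors satisfy them.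
\<close>

section \<open>Inner product in spin components\<close>

lemma quantum_numbers: "{-2..2} = {-2, -1, 0, 1, 2 :: int}"
  by auto

lemma inner_spin_comp:
  "x \<bullet> y = spin_comp x 2 \<bullet> spin_comp y 2 + spin_comp x 1 \<bullet> spin_comp y 1 + spin_comp x 0 \<bullet> spin_comp y 0
     + spin_comp x (- 1) \<bullet> spin_comp y (- 1) + spin_comp x (- 2) \<bullet> spin_comp y (- 2)"
proof -
  have "\<exists>z\<in>{0..<5}. i = of_int z" for i :: 5
    by (cases i) force
  moreover have "{0..<5} = {0, 1, 2, 3, 4 :: int}"
    by auto
  ultimately have "UNIV = {0, 1, 2, 3, 4 :: 5}"
    by (auto 4 4)
  \<comment> \<open>The component \<open>-2\<close> is read off at the index \<open>5\<close>, another name of \<open>0\<close> in this cyclic type.\<close>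
  moreover have "(0 :: 5) = 5"
    by simp
  ultimately have UNIV_5: "UNIV = {5, 1, 2, 3, 4 :: 5}"
    by (simp only:)
  show ?thesis
    unfolding inner_vec_def spin_comp_def UNIV_5 by simp
qed

lemma norm_spin_comp_sqr:
  "(norm x)\<^sup>2 = (\<Sum>l\<in>{-2..2}. (norm (spin_comp x l))\<^sup>2)"
  by (simp add: quantum_numbers power2_norm_eq_inner inner_spin_comp)

lemma spin_comp_scale: "spin_comp (z *s x) l = z * spin_comp x l"
  by (simp add: spin_comp_def)

section \<open>Time reversal and spin operators\<close>

text \<open>
  The antiunitary map \<open>\<Theta>\<close>; the signs \<open>(-1)\<^sup>l\<close> are those of \<open>\<delta>\<close>, so that \<open>\<delta> = \<langle>\<Theta>\<xi>, \<xi>\<rangle>\<close>.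
\<close>

definition time_reversal :: "complex ^ 5 \<Rightarrow> complex ^ 5"
  where "time_reversal \<xi> = vector
    [cnj (spin_comp \<xi> (- 2)), - cnj (spin_comp \<xi> (- 1)), cnj (spin_comp \<xi> 0),
     - cnj (spin_comp \<xi> 1), cnj (spin_comp \<xi> 2)]"

text \<open>
  The Hermitian operator \<open>m F\<^sub>z + (cnj t F\<^sub>+ + t F\<^sub>-) / 2\<close>, that is \<open>n\<^sub>x F\<^sub>x + n\<^sub>y F\<^sub>y + n\<^sub>z F\<^sub>z\<close> for the
  direction \<open>n = (Re t, Im t, m)\<close>. The coefficients \<open>2\<close> and \<open>sqrt 6\<close> of \<open>\<tau>\<close> are the matrix entries of \<open>F\<^sub>+\<close>.
\<close>

definition spin_op :: "real \<Rightarrow> complex \<Rightarrow> complex ^ 5 \<Rightarrow> complex ^ 5"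
  where "spin_op m t \<xi> = vector
    [2 * m * spin_comp \<xi> 2 + cnj t * spin_comp \<xi> 1,
     m * spin_comp \<xi> 1 + t * spin_comp \<xi> 2 + sqrt 6 / 2 * (cnj t * spin_comp \<xi> 0),
     sqrt 6 / 2 * (t * spin_comp \<xi> 1 + cnj t * spin_comp \<xi> (- 1)),
     - m * spin_comp \<xi> (- 1) + cnj t * spin_comp \<xi> (- 2) + sqrt 6 / 2 * (t * spin_comp \<xi> 0),
     - 2 * m * spin_comp \<xi> (- 2) + t * spin_comp \<xi> (- 1)]"

lemma sqrt6_mult: "sqrt 6 * (sqrt 6 * x) = 6 * x"
  by (simp flip: mult.assoc)

text \<open>
  Let \<open>G = spin_op m t\<close> and \<open>n = (Re t, Im t, m)\<close>. As \<open>G\<close> has the eigenvalues \<open>0\<close>, \<open>\<plusminus>\<bar>n\<bar>\<close>, \<open>\<plusminus>2\<bar>n\<bar>\<close>, the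
  operator \<open>4 \<bar>n\<bar>\<^sup>2 - G\<^sup>2\<close> is positive; writing its quadratic form as an explicit sum of squares
  avoids diagonalising \<open>G\<close>. To find the squares, view \<open>\<xi>\<close> as a symmetric traceless matrix \<open>X\<close> of
  order 3, and \<open>G\<close>, up to a factor \<open>\<i>\<close>, as the commutator \<open>X \<mapsto> [N, X]\<close> with the matrix \<open>N\<close> of the
  cross product by \<open>n\<close>. Then \<open>4 \<bar>n\<bar>\<^sup>2 \<bar>X\<bar>\<^sup>2 - \<bar>[N, X]\<bar>\<^sup>2 = 6 \<bar>X n\<bar>\<^sup>2\<close>: the parallelogram law turns the left
  side into \<open>4 (\<bar>n\<bar>\<^sup>2 \<bar>X\<bar>\<^sup>2 - \<bar>N X\<bar>\<^sup>2) + \<bar>N X + X N\<bar>\<^sup>2\<close>, where the bracket is \<open>\<bar>X n\<bar>\<^sup>2\<close>, and \<open>N X + X N\<close> is,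
  up to sign, the cross product matrix of \<open>X n\<close>. The three squares below are, up to scaling, those
  of the spherical components of \<open>X n\<close>.
\<close>

lemma spin_op_norm_identity:
  "(norm (spin_op m t \<xi>))\<^sup>2
     + (1 / 2 * (norm (sqrt 6 * (t * spin_comp \<xi> 2 - m * spin_comp \<xi> 1) - cnj t * spin_comp \<xi> 0))\<^sup>2
       + (norm (sqrt 6 / 2 * (t * spin_comp \<xi> 1 - cnj t * spin_comp \<xi> (- 1)) - 2 * (m * spin_comp \<xi> 0)))\<^sup>2
       + 1 / 2 * (norm (sqrt 6 * (cnj t * spin_comp \<xi> (- 2) + m * spin_comp \<xi> (- 1)) - t * spin_comp \<xi> 0))\<^sup>2)
   = 4 * (m\<^sup>2 + (norm t)\<^sup>2) * (norm \<xi>)\<^sup>2"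
  unfolding power2_norm_eq_inner[of "spin_op m t \<xi>"] power2_norm_eq_inner[of \<xi>] inner_spin_comp
  unfolding spin_op_def spin_comp_vector inner_complex_def cmod_power2
  by (simp add: power2_eq_square)
    (simp add: algebra_simps sqrt6_mult add_divide_distrib diff_divide_distrib)

lemma norm_spin_op_le: "norm (spin_op m t \<xi>) \<le> 2 * sqrt (m\<^sup>2 + (norm t)\<^sup>2) * norm \<xi>"
proof (rule power2_le_imp_le)
  have "(norm (spin_op m t \<xi>))\<^sup>2 \<le> 4 * (m\<^sup>2 + (norm t)\<^sup>2) * (norm \<xi>)\<^sup>2"
    unfolding spin_op_norm_identity[symmetric]
    by (intro le_add_same_cancel1[THEN iffD2] add_nonneg_nonneg) simp_all
  then show "(norm (spin_op m t \<xi>))\<^sup>2 \<le> (2 * sqrt (m\<^sup>2 + (norm t)\<^sup>2) * norm \<xi>)\<^sup>2"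
    by (simp add: power_mult_distrib)
qed simp

text \<open>
  The expectation value of a spin component is the inner product of its direction with the spin
  vector of \<open>\<xi>\<close>. For the direction of the spin vector itself this is the squared length.
\<close>

lemma inner_spin_op:
  "\<xi> \<bullet> spin_op m t \<xi>
     = m * (\<Sum>l\<in>{-2..2}. real_of_int l * (norm (spin_comp \<xi> l))\<^sup>2) + t \<bullet> \<tau> \<xi>"
  by (simp add: quantum_numbers inner_spin_comp spin_op_def spin_comp_vector \<tau>_def
        inner_complex_def cmod_power2)
    (simp add: field_simps power2_eq_square)

text \<open>
  \<open>\<Theta>\<close> is an antiunitary involution and \<open>G \<Theta> = - \<Theta> G\<close> for every spin operator \<open>G\<close>, hence
  \<open>\<langle>\<Theta>\<xi>, G\<xi>\<rangle> = \<langle>G\<Theta>\<xi>, \<xi>\<rangle> = - \<langle>\<Theta>G\<xi>, \<xi>\<rangle> = - \<langle>\<Theta>\<xi>, G\<xi>\<rangle>\<close>. The operation \<open>\<bullet>\<close> is only the real part of the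
  Hermitian inner product; the factor \<open>z\<close> recovers orthogonality in the Hermitian sense.
\<close>

lemma spin_op_orthogonal:
  "(z *s time_reversal \<xi>) \<bullet> spin_op m t \<xi> = 0"
  by (simp add: inner_spin_comp spin_op_def time_reversal_def spin_comp_vector spin_comp_scale
        inner_complex_def)
    (simp add: field_simps)

lemma inner_time_reversal: "(z *s time_reversal \<xi>) \<bullet> \<xi> = z \<bullet> \<delta> \<xi>"
  by (simp add: inner_spin_comp time_reversal_def spin_comp_vector spin_comp_scale
        inner_complex_def \<delta>_def power2_eq_square)
    (simp add: field_simps)

lemma norm_time_reversal: "norm (time_reversal \<xi>) = norm \<xi>"
  by (simp add: norm_eq inner_spin_comp time_reversal_def spin_comp_vector inner_complex_def)

lemma norm_minus_time_reversal:
  "(norm (\<xi> - \<delta> \<xi> *s time_reversal \<xi>))\<^sup>2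
     = (norm \<xi>)\<^sup>2 - 2 * (norm (\<delta> \<xi>))\<^sup>2 + (norm (\<delta> \<xi>))\<^sup>2 * (norm \<xi>)\<^sup>2"
proof -
  have "(norm (\<delta> \<xi> *s time_reversal \<xi>))\<^sup>2 = (norm (\<delta> \<xi>))\<^sup>2 * (norm \<xi>)\<^sup>2"
    unfolding norm_time_reversal[of \<xi>, symmetric]
    by (simp add: norm_spin_comp_sqr spin_comp_scale norm_mult power_mult_distrib sum_distrib_left)
  then show ?thesis
    using inner_time_reversal[of "\<delta> \<xi>" \<xi>]
    by (simp add: power2_norm_eq_inner algebra_simps inner_commute)
qed

section \<open>The bound on spin and singlet amplitude\<close>

text \<open>
  Cauchy-Schwarz is applied to \<open>G\<xi>\<close>, for \<open>G\<close> the spin operator in the direction of the spin vector,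
  and the component of \<open>\<xi>\<close> orthogonal to \<open>\<Theta>\<xi>\<close>. Applying it to \<open>\<xi>\<close> itself would give only
  \<open>M\<^sup>2 + \<bar>\<tau>\<bar>\<^sup>2 \<le> 4\<close>.
\<close>

lemma spin_singlet_bound:
  assumes "\<xi> \<in> feasible_set M"
  shows "M\<^sup>2 + (norm (\<tau> \<xi>))\<^sup>2 + 4 * (norm (\<delta> \<xi>))\<^sup>2 \<le> 4"
proof -
  define p where "p = M\<^sup>2 + (norm (\<tau> \<xi>))\<^sup>2"
  define q where "q = (norm (\<delta> \<xi>))\<^sup>2"
  \<comment> \<open>the component of \<open>\<xi>\<close> orthogonal to the unit vector \<open>time_reversal \<xi>\<close>\<close>
  define w where "w = \<xi> - \<delta> \<xi> *s time_reversal \<xi>"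
  have unit: "norm \<xi> = 1"
    using assms norm_spin_comp_sqr[of \<xi>] norm_ge_zero[of \<xi>]
    by (auto simp: feasible_set_def power2_eq_1_iff simp del: norm_ge_zero)
  have p0: "0 \<le> p"
    by (simp add: p_def)
  have w2: "(norm w)\<^sup>2 = 1 - q"
    unfolding w_def q_def norm_minus_time_reversal unit by simp
  have "p = \<xi> \<bullet> spin_op M (\<tau> \<xi>) \<xi>"
    using assms by (simp add: inner_spin_op p_def feasible_set_def power2_norm_eq_inner
        power2_eq_square[of M])
  also have "\<dots> = w \<bullet> spin_op M (\<tau> \<xi>) \<xi>"
    by (simp add: w_def inner_diff_left spin_op_orthogonal)
  also have "\<dots> \<le> norm w * norm (spin_op M (\<tau> \<xi>) \<xi>)"
    by (rule norm_cauchy_schwarz)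
  also have "\<dots> \<le> norm w * (2 * sqrt p)"
    using norm_spin_op_le[of M "\<tau> \<xi>" \<xi>] unit by (intro mult_left_mono) (auto simp: p_def)
  finally have "sqrt p * sqrt p \<le> sqrt p * (2 * norm w)"
    using p0 by (simp add: mult_ac)
  then have "sqrt p \<le> 2 * norm w"
    using p0 by (cases "p = 0") (simp_all add: mult_le_cancel_left_pos del: real_sqrt_mult_self)
  then have "p \<le> 4 * (norm w)\<^sup>2"
    using p0 power_mono[of "sqrt p" "2 * norm w" 2] by (simp add: power_mult_distrib)
  then show ?thesis
    unfolding w2 p_def q_def by simp
qed

section \<open>Characterisation of the ground states\<close>

definition nematic_energy :: "real \<Rightarrow> real \<Rightarrow> real \<Rightarrow> real \<Rightarrow> real"
  where "nematic_energy \<beta>\<^sub>0 \<beta>\<^sub>1 \<beta>\<^sub>2 M = 1 / 2 * (\<beta>\<^sub>2 / 5 * (1 - M\<^sup>2 / 4) + \<beta>\<^sub>0 + \<beta>\<^sub>1 * M\<^sup>2)"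

text \<open>
  The excess over \<open>nematic_energy\<close> is a combination of \<open>\<bar>\<tau>\<bar>\<^sup>2\<close> and of the slack in
  \<open>spin_singlet_bound\<close>. The conditions \<open>\<beta>\<^sub>2 < 20 \<beta>\<^sub>1\<close> and \<open>\<beta>\<^sub>2 < 0\<close> say precisely that the two
  coefficients are positive.
\<close>

lemma energy_excess:
  "energy \<beta>\<^sub>0 \<beta>\<^sub>1 \<beta>\<^sub>2 M \<xi> =
     nematic_energy \<beta>\<^sub>0 \<beta>\<^sub>1 \<beta>\<^sub>2 M
     + (\<beta>\<^sub>1 - \<beta>\<^sub>2 / 20) / 2 * (norm (\<tau> \<xi>))\<^sup>2
     + (- \<beta>\<^sub>2 / 40) * (4 - (M\<^sup>2 + (norm (\<tau> \<xi>))\<^sup>2 + 4 * (norm (\<delta> \<xi>))\<^sup>2))"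
  unfolding energy_def nematic_energy_def by (simp add: field_simps)

lemma
  assumes "\<beta>\<^sub>2 < 0" "\<beta>\<^sub>2 < 20 * \<beta>\<^sub>1" "\<xi> \<in> feasible_set M"
  shows energy_ge_nematic_energy: "nematic_energy \<beta>\<^sub>0 \<beta>\<^sub>1 \<beta>\<^sub>2 M \<le> energy \<beta>\<^sub>0 \<beta>\<^sub>1 \<beta>\<^sub>2 M \<xi>"
    and energy_eq_nematic_energy_iff: "energy \<beta>\<^sub>0 \<beta>\<^sub>1 \<beta>\<^sub>2 M \<xi> = nematic_energy \<beta>\<^sub>0 \<beta>\<^sub>1 \<beta>\<^sub>2 M \<longleftrightarrow>
        \<tau> \<xi> = 0 \<and> (norm (\<delta> \<xi>))\<^sup>2 = 1 - M\<^sup>2 / 4"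
proof -
  let ?x = "(\<beta>\<^sub>1 - \<beta>\<^sub>2 / 20) / 2 * (norm (\<tau> \<xi>))\<^sup>2"
  let ?y = "(- \<beta>\<^sub>2 / 40) * (4 - (M\<^sup>2 + (norm (\<tau> \<xi>))\<^sup>2 + 4 * (norm (\<delta> \<xi>))\<^sup>2))"
  have x: "0 \<le> ?x" "?x = 0 \<longleftrightarrow> \<tau> \<xi> = 0"
    using assms(2) by simp_all
  have y: "0 \<le> ?y" "?y = 0 \<longleftrightarrow> M\<^sup>2 + (norm (\<tau> \<xi>))\<^sup>2 + 4 * (norm (\<delta> \<xi>))\<^sup>2 = 4"
    using spin_singlet_bound[OF assms(3)] assms(1) by (auto intro: mult_nonpos_nonneg)
  show "nematic_energy \<beta>\<^sub>0 \<beta>\<^sub>1 \<beta>\<^sub>2 M \<le> energy \<beta>\<^sub>0 \<beta>\<^sub>1 \<beta>\<^sub>2 M \<xi>"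
    unfolding energy_excess[of _ _ _ _ \<xi>] using x(1) y(1) by linarith
  have "energy \<beta>\<^sub>0 \<beta>\<^sub>1 \<beta>\<^sub>2 M \<xi> = nematic_energy \<beta>\<^sub>0 \<beta>\<^sub>1 \<beta>\<^sub>2 M \<longleftrightarrow> ?x = 0 \<and> ?y = 0"
    unfolding energy_excess[of _ _ _ _ \<xi>] using x(1) y(1) by linarith
  also have "\<dots> \<longleftrightarrow> \<tau> \<xi> = 0 \<and> (norm (\<delta> \<xi>))\<^sup>2 = 1 - M\<^sup>2 / 4"
    unfolding x(2) y(2) by auto
  finally show "energy \<beta>\<^sub>0 \<beta>\<^sub>1 \<beta>\<^sub>2 M \<xi> = nematic_energy \<beta>\<^sub>0 \<beta>\<^sub>1 \<beta>\<^sub>2 M \<longleftrightarrow>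
        \<tau> \<xi> = 0 \<and> (norm (\<delta> \<xi>))\<^sup>2 = 1 - M\<^sup>2 / 4" .
qed

lemma vector_feasible_iff:
  "vector [a, b, c, d, e] \<in> feasible_set M \<longleftrightarrow>
     (norm a)\<^sup>2 + (norm b)\<^sup>2 + (norm c)\<^sup>2 + (norm d)\<^sup>2 + (norm e)\<^sup>2 = 1 \<and>
     2 * (norm a)\<^sup>2 + (norm b)\<^sup>2 - (norm d)\<^sup>2 - 2 * (norm e)\<^sup>2 = M"
  by (simp add: quantum_numbers feasible_set_def spin_comp_vector algebra_simps)

lemma two_component_state:
  fixes M :: real
  assumes "0 \<le> M" "M \<le> 2"
  defines "\<xi> \<equiv> vector [complex_of_real (sqrt (2 + M) / 2), 0, 0, 0, complex_of_real (sqrt (2 - M) / 2)]"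
  shows "\<xi> \<in> feasible_set M" "\<tau> \<xi> = 0" "(norm (\<delta> \<xi>))\<^sup>2 = 1 - M\<^sup>2 / 4"
  using assms
  by (auto simp: vector_feasible_iff \<tau>_def \<delta>_def spin_comp_vector norm_mult power_mult_distrib
      power_divide field_simps power2_eq_square)

text \<open>
  The two-component state lies in the feasible set and attains the lower bound, so every minimizer
  has to attain it as well.
\<close>

lemma ground_state_iff:
  assumes "\<beta>\<^sub>2 < 0" "\<beta>\<^sub>2 < 20 * \<beta>\<^sub>1" "0 \<le> M" "M \<le> 2"
  shows "ground_state \<beta>\<^sub>0 \<beta>\<^sub>1 \<beta>\<^sub>2 M \<xi> \<longleftrightarrow>
    \<xi> \<in> feasible_set M \<and> \<tau> \<xi> = 0 \<and> (norm (\<delta> \<xi>))\<^sup>2 = 1 - M\<^sup>2 / 4"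
proof
  let ?\<eta> = "vector [complex_of_real (sqrt (2 + M) / 2), 0, 0, 0, complex_of_real (sqrt (2 - M) / 2)]"
  note \<eta> = two_component_state[OF assms(3,4)]
  assume g: "ground_state \<beta>\<^sub>0 \<beta>\<^sub>1 \<beta>\<^sub>2 M \<xi>"
  then have feas: "\<xi> \<in> feasible_set M"
    by (simp add: ground_state_def is_arg_min_linorder)
  have "energy \<beta>\<^sub>0 \<beta>\<^sub>1 \<beta>\<^sub>2 M \<xi> \<le> energy \<beta>\<^sub>0 \<beta>\<^sub>1 \<beta>\<^sub>2 M ?\<eta>"
    using g \<eta>(1) by (simp add: ground_state_def is_arg_min_linorder)
  also have "\<dots> = nematic_energy \<beta>\<^sub>0 \<beta>\<^sub>1 \<beta>\<^sub>2 M"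
    using energy_eq_nematic_energy_iff[OF assms(1,2) \<eta>(1)] \<eta>(2,3) by blast
  finally have "energy \<beta>\<^sub>0 \<beta>\<^sub>1 \<beta>\<^sub>2 M \<xi> = nematic_energy \<beta>\<^sub>0 \<beta>\<^sub>1 \<beta>\<^sub>2 M"
    using energy_ge_nematic_energy[OF assms(1,2) feas] by (meson antisym)
  then show "\<xi> \<in> feasible_set M \<and> \<tau> \<xi> = 0 \<and> (norm (\<delta> \<xi>))\<^sup>2 = 1 - M\<^sup>2 / 4"
    using energy_eq_nematic_energy_iff[OF assms(1,2) feas] feas by blast
next
  assume "\<xi> \<in> feasible_set M \<and> \<tau> \<xi> = 0 \<and> (norm (\<delta> \<xi>))\<^sup>2 = 1 - M\<^sup>2 / 4"
  then show "ground_state \<beta>\<^sub>0 \<beta>\<^sub>1 \<beta>\<^sub>2 M \<xi>"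
    unfolding ground_state_def is_arg_min_linorder
    using energy_ge_nematic_energy[OF assms(1,2)] energy_eq_nematic_energy_iff[OF assms(1,2)] by metis
qed

section \<open>Nematic states of zero magnetization\<close>

text \<open>
  The two families below are the real unit vectors with \<open>\<Theta>\<xi> = \<xi>\<close> and with \<open>\<Theta>\<xi> = - \<xi>\<close>. So
  \<open>\<bar>\<delta>\<bar> = \<bar>\<langle>\<Theta>\<xi>, \<xi>\<rangle>\<bar> = 1\<close>, and the spin vector vanishes because time reversal changes its sign.
\<close>

lemma symmetric_zero_magnetization_state:
  fixes a b c :: real
  assumes "2 * a\<^sup>2 + 2 * b\<^sup>2 + c\<^sup>2 = 1"
  defines "\<xi> \<equiv> vector [complex_of_real a, complex_of_real b, complex_of_real c, complex_of_real (- b), complex_of_real a]"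
  shows "\<xi> \<in> feasible_set 0" "\<tau> \<xi> = 0" "(norm (\<delta> \<xi>))\<^sup>2 = 1"
proof -
  have "\<delta> \<xi> = complex_of_real (2 * a\<^sup>2 + 2 * b\<^sup>2 + c\<^sup>2)"
    by (simp add: \<xi>_def \<delta>_def spin_comp_vector power2_eq_square)
  then show "(norm (\<delta> \<xi>))\<^sup>2 = 1"
    unfolding assms(1) by simp
qed (use assms in \<open>auto simp: vector_feasible_iff \<tau>_def spin_comp_vector\<close>)

lemma antisymmetric_zero_magnetization_state:
  fixes a b :: real
  assumes "2 * a\<^sup>2 + 2 * b\<^sup>2 = 1"
  defines "\<xi> \<equiv> vector [complex_of_real a, complex_of_real b, 0, complex_of_real b, complex_of_real (- a)]"
  shows "\<xi> \<in> feasible_set 0" "\<tau> \<xi> = 0" "(norm (\<delta> \<xi>))\<^sup>2 = 1"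
proof -
  have "\<delta> \<xi> = - complex_of_real (2 * a\<^sup>2 + 2 * b\<^sup>2)"
    by (simp add: \<xi>_def \<delta>_def spin_comp_vector power2_eq_square)
  then show "(norm (\<delta> \<xi>))\<^sup>2 = 1"
    unfolding assms(1) by simp
qed (use assms in \<open>auto simp: vector_feasible_iff \<tau>_def spin_comp_vector\<close>)

theorem lemma2p4:
  fixes \<beta>\<^sub>0 \<beta>\<^sub>1 \<beta>\<^sub>2 M :: real
  assumes "\<beta>\<^sub>2 < 0" and "\<beta>\<^sub>2 < 20 * \<beta>\<^sub>1" and "0 \<le> M" and "M < 2"
  shows "(\<forall>\<xi>. ground_state \<beta>\<^sub>0 \<beta>\<^sub>1 \<beta>\<^sub>2 M \<xi> \<longrightarrow> nematic \<xi>)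
    \<and> (0 < M \<longrightarrow>
        ground_state \<beta>\<^sub>0 \<beta>\<^sub>1 \<beta>\<^sub>2 M
          (vector [complex_of_real (sqrt (2 + M) / 2), 0, 0, 0,
                   complex_of_real (sqrt (2 - M) / 2)]))
    \<and> (M = 0 \<longrightarrow>
        (\<forall>\<gamma> \<theta> :: real. \<bar>\<gamma>\<bar> \<le> 1 \<longrightarrow> \<theta> \<in> {0..<2 * pi} \<longrightarrow>
          (let \<gamma>\<^sub>1 = sqrt ((1 - \<gamma>\<^sup>2) / 2) in
            ground_state \<beta>\<^sub>0 \<beta>\<^sub>1 \<beta>\<^sub>2 M
              (vector [complex_of_real (\<gamma>\<^sub>1 * cos \<theta>), complex_of_real (\<gamma>\<^sub>1 * sin \<theta>),
                       complex_of_real \<gamma>,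
                       complex_of_real (- \<gamma>\<^sub>1 * sin \<theta>), complex_of_real (\<gamma>\<^sub>1 * cos \<theta>)])))
        \<and> (\<forall>\<theta> :: real. \<theta> \<in> {0..<2 * pi} \<longrightarrow>
            ground_state \<beta>\<^sub>0 \<beta>\<^sub>1 \<beta>\<^sub>2 M
              (vector [complex_of_real (cos \<theta> / sqrt 2), complex_of_real (sin \<theta> / sqrt 2),
                       0,
                       complex_of_real (sin \<theta> / sqrt 2), complex_of_real (- cos \<theta> / sqrt 2)])))"
proof (intro conjI impI allI)
  fix \<xi>
  assume "ground_state \<beta>\<^sub>0 \<beta>\<^sub>1 \<beta>\<^sub>2 M \<xi>"
  then have "\<tau> \<xi> = 0" "(norm (\<delta> \<xi>))\<^sup>2 = 1 - M\<^sup>2 / 4"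
    using assms by (simp_all add: ground_state_iff)
  moreover have "M\<^sup>2 < 2\<^sup>2"
    using assms by (intro power_strict_mono) auto
  ultimately show "nematic \<xi>"
    unfolding nematic_def by (auto simp: power2_eq_square)
next
  show "ground_state \<beta>\<^sub>0 \<beta>\<^sub>1 \<beta>\<^sub>2 M
      (vector [complex_of_real (sqrt (2 + M) / 2), 0, 0, 0, complex_of_real (sqrt (2 - M) / 2)])"
    using assms two_component_state[of M] by (simp add: ground_state_iff)
next
  fix \<gamma> \<theta> :: real
  assume M: "M = 0" and "\<bar>\<gamma>\<bar> \<le> 1"
  then have "\<gamma>\<^sup>2 \<le> 1"
    by (simp add: abs_square_le_1)
  define \<gamma>\<^sub>1 where "\<gamma>\<^sub>1 = sqrt ((1 - \<gamma>\<^sup>2) / 2)"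
  have "2 * \<gamma>\<^sub>1\<^sup>2 * ((sin \<theta>)\<^sup>2 + (cos \<theta>)\<^sup>2) + \<gamma>\<^sup>2 = 1"
    using \<open>\<gamma>\<^sup>2 \<le> 1\<close> by (simp add: \<gamma>\<^sub>1_def field_simps)
  then have "2 * (\<gamma>\<^sub>1 * cos \<theta>)\<^sup>2 + 2 * (\<gamma>\<^sub>1 * sin \<theta>)\<^sup>2 + \<gamma>\<^sup>2 = 1"
    by (simp only: power_mult_distrib) (simp only: algebra_simps)
  from symmetric_zero_magnetization_state[OF this]
  show "let \<gamma>\<^sub>1 = sqrt ((1 - \<gamma>\<^sup>2) / 2) in
      ground_state \<beta>\<^sub>0 \<beta>\<^sub>1 \<beta>\<^sub>2 M
        (vector [complex_of_real (\<gamma>\<^sub>1 * cos \<theta>), complex_of_real (\<gamma>\<^sub>1 * sin \<theta>),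
                 complex_of_real \<gamma>,
                 complex_of_real (- \<gamma>\<^sub>1 * sin \<theta>), complex_of_real (\<gamma>\<^sub>1 * cos \<theta>)])"
    unfolding Let_def \<gamma>\<^sub>1_def[symmetric] M using assms by (simp add: ground_state_iff)
next
  fix \<theta> :: real
  assume M: "M = 0"
  have "2 * (cos \<theta> / sqrt 2)\<^sup>2 + 2 * (sin \<theta> / sqrt 2)\<^sup>2 = 1"
    by (simp add: power_divide)
  from antisymmetric_zero_magnetization_state[OF this]
  show "ground_state \<beta>\<^sub>0 \<beta>\<^sub>1 \<beta>\<^sub>2 M
      (vector [complex_of_real (cos \<theta> / sqrt 2), complex_of_real (sin \<theta> / sqrt 2), 0,
               complex_of_real (sin \<theta> / sqrt 2), complex_of_real (- cos \<theta> / sqrt 2)])"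
    unfolding M using assms by (simp add: ground_state_iff)
qed

end
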